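(* Suppose that for $1\le k\le n$ and $1\le i\le d_y$ one has $\underline{y}_k^{(i)}>-\infty$ and $\bar{y}_k^{(i)}<\infty$. Then the output of the optimal zeroth moment robust probabilistic predictor $\mathscr{F}_k^\star$ is the uniform distribution $$\hat{p}^\star_{\mathbf{y}_k\mid\mathbf{y}_{1:k-1}}(s\mid y_{1:k-1})=\begin{cases}\prod_{i=1}^{d_y}\left(\bar{y}_k^{(i)}-\underline{y}_k^{(i)}\right)^{-1}, & s\in\operatorname{supp}(\mathbf{y}_k),\\ 0,&\text{else.}\end{cases}$$
   Context: System $\Phi$: $\mathbf{x}_k=f(\mathbf{x}_{k-1},\mathbf{u}_{k-1})+\mathbf{w}_{k-1}$, $\mathbf{y}_k=h(\mathbf{x}_k)+\mathbf{v}_k$, with outputs $\mathbf{y}_k\in\mathbb{R}^{d_y}$, independent noises $\mathbf{w}_k,\mathbf{v}_k$, no cross-correlation among $\mathbf{w}_k,\mathbf{v}_k,\mathbf{u}_k$, and $\mathbf{x}_0$ independent of them. $p_{\mathbf{y}_k\mid\mathbf{y}_{1:k-1}}$ is the true conditional density of $\mathbf{y}_k$, and $\operatorname{supp}(\mathbf{y}_k)=\{v\in\mathbb{R}^{d_y}\mid\underline{y}_k^{(i)}\le v^{(i)}\le\bar{y}_k^{(i)},\,1\le i\le d_y\}$ with $\underline{y}_k^{(i)},\bar{y}_k^{(i)}\in\mathbb{R}\cup\{\pm\infty\}$. For a multi-index $\alpha$, $s^\alpha=\prod_i(s^{(i)})^{\alpha^{(i)}}$ and $|\alpha|=\sum_i\alpha^{(i)}$.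 The $m$-th moment information set is $\mathcal{I}_m:=\{|\mu_\alpha(\mathbf{v})|<\infty,\ \forall\,\mathbf{v}\in\{\mathbf{w}_{1:n},\mathbf{v}_{1:n},\mathbf{u}_{1:n},\mathbf{x}_0\},\ |\alpha|\le m\}$, where $\mu_\alpha(\mathbf{v})=\int s^\alpha p_{\mathbf{v}}(s)\,\mathrm{d}s$. An $m$-th moment robust probabilistic predictor is a predictor $\mathscr{F}=(\mathscr{F}_k)$ whose time-$k$ output $\mathscr{F}_k(y_{1:k-1};\mathcal{I}_m)=\hat{p}_{\mathbf{y}_k\mid\mathbf{y}_{1:k-1}}(\cdot\mid y_{1:k-1})$ is a probability density of the form $s\mapsto e^{\sum_{i=0}^m\sum_{|\alpha|=i}\lambda_\alpha s^\alpha}$ on $\operatorname{supp}(\mathbf{y}_k)$ (zero elsewhere), $\lambda_\alpha\in\mathbb{R}$. It is optimal if the parameters $\lambda_\alpha$ maximize the prediction performance, i.e. the one-step expected log-likelihood $\int p_{\mathbf{y}_k\mid\mathbf{y}_{1:k-1}}(s\mid y_{1:k-1})\log\hat{p}_{\mathbf{y}_k\mid\mathbf{y}_{1:k-1}}(s\mid y_{1:k-1})\,\mathrm{d}s$, among densities of this form. *)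

theory Defs
  imports "HOL-Probability.Probability"
begin

section \<open>Supports, conditional densities, independence and cross-correlation\<close>

text \<open>Topological support of the distribution of a random vector.\<close>

definition rv_support :: "'a measure \<Rightarrow> ('a \<Rightarrow> 'b::topological_space) \<Rightarrow> 'b set" where
  "rv_support M X = {s. \<forall>U. open U \<longrightarrow> s \<in> U \<longrightarrow> 0 < emeasure (distr M borel X) U}"

definition ereal_box :: "('d \<Rightarrow> ereal) \<Rightarrow> ('d \<Rightarrow> ereal) \<Rightarrow> (real ^ 'd::finite) set" where
  "ereal_box lo hi = {s. \<forall>i. lo i \<le> ereal (s $ i) \<and> ereal (s $ i) \<le> hi i}"

definition prob_density :: "(real ^ 'd::finite \<Rightarrow> real) \<Rightarrow> bool" where
  "prob_density q \<longleftrightarrow>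
     q \<in> borel_measurable borel \<and> (\<forall>s. 0 \<le> q s) \<and> (\<integral>\<^sup>+ s. ennreal (q s) \<partial>lborel) = 1"

text \<open>\<open>p z\<close> is the density of \<open>Y\<close> given \<open>Z = z\<close>. Conditional densities are determined only up to
  null sets of values of \<open>Z\<close>; any version that is a density for each \<open>z\<close> is admitted.\<close>

definition cond_density ::
  "'a measure \<Rightarrow> 'c measure \<Rightarrow> ('a \<Rightarrow> 'c) \<Rightarrow> ('a \<Rightarrow> real ^ 'd::finite) \<Rightarrow>
   ('c \<Rightarrow> real ^ 'd \<Rightarrow> real) \<Rightarrow> bool" where
  "cond_density M N Z Y p \<longleftrightarrow>
     case_prod p \<in> borel_measurable (N \<Otimes>\<^sub>M borel) \<and>
     (\<forall>z\<in>space N. prob_density (p z)) \<and>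
     (\<forall>A\<in>sets N. \<forall>B\<in>sets borel.
        emeasure M {\<omega>\<in>space M. Z \<omega> \<in> A \<and> Y \<omega> \<in> B} =
        (\<integral>\<^sup>+ z\<in>A. (\<integral>\<^sup>+ s\<in>B. ennreal (p z s) \<partial>lborel) \<partial>distr M N Z))"

text \<open>The noises, inputs and states take values in different spaces, whereas \<open>indep_vars\<close> and
  \<open>indep_var\<close> require a common type. Independence is therefore stated for the generated
  \<open>\<sigma>\<close>-algebras.\<close>

definition rv_events :: "'a measure \<Rightarrow> 'b measure \<Rightarrow> ('a \<Rightarrow> 'b) \<Rightarrow> 'a set set" where
  "rv_events M N X = {X -` A \<inter> space M | A. A \<in> sets N}"

text \<open>The cross-covariances vanish. Finite second moments are not presupposed, so the
  requirement applies to those components for which the cross-covariance is defined.\<close>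

definition uncorrelated ::
  "'a measure \<Rightarrow> ('a \<Rightarrow> real ^ 'c::finite) \<Rightarrow> ('a \<Rightarrow> real ^ 'd::finite) \<Rightarrow> bool" where
  "uncorrelated M X Y \<longleftrightarrow>
     (\<forall>i j. integrable M (\<lambda>\<omega>. (X \<omega> $ i)\<^sup>2) \<longrightarrow> integrable M (\<lambda>\<omega>. (Y \<omega> $ j)\<^sup>2) \<longrightarrow>
        (\<integral>\<omega>. X \<omega> $ i * Y \<omega> $ j \<partial>M) = (\<integral>\<omega>. X \<omega> $ i \<partial>M) * (\<integral>\<omega>. Y \<omega> $ j \<partial>M))"


section \<open>The stochastic system\<close>

text \<open>The functions \<open>pw k\<close>, \<open>pv k\<close>, \<open>pu k\<close> and \<open>px0\<close> are the densities of \<open>w k\<close>, \<open>v k\<close>, \<open>u k\<close>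
  and \<open>x 0\<close>; the bounds \<open>lo k\<close> and \<open>hi k\<close> describe the support of \<open>y k\<close>; \<open>p k past\<close> is the density
  of \<open>y k\<close> given that \<open>y 1, \<dots>, y (k - 1)\<close> take the values \<open>past 1, \<dots>, past (k - 1)\<close>.
  For \<open>k = 1\<close> the space of past outputs is a singleton.\<close>

abbreviation past_space :: "nat \<Rightarrow> (nat \<Rightarrow> real ^ 'd::finite) measure" where
  "past_space k \<equiv> Pi\<^sub>M {1..<k} (\<lambda>_. borel)"

locale stochastic_system = prob_space M
  for M :: "'a measure" +
  fixes n :: nat
    and f :: "real ^ 'x::finite \<Rightarrow> real ^ 'u::finite \<Rightarrow> real ^ 'x"
    and h :: "real ^ 'x \<Rightarrow> real ^ 'y::finite"
    and x w :: "nat \<Rightarrow> 'a \<Rightarrow> real ^ 'x"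
    and u :: "nat \<Rightarrow> 'a \<Rightarrow> real ^ 'u"
    and v y :: "nat \<Rightarrow> 'a \<Rightarrow> real ^ 'y"
    and pw :: "nat \<Rightarrow> real ^ 'x \<Rightarrow> real"
    and pv :: "nat \<Rightarrow> real ^ 'y \<Rightarrow> real"
    and pu :: "nat \<Rightarrow> real ^ 'u \<Rightarrow> real"
    and px0 :: "real ^ 'x \<Rightarrow> real"
    and lo hi :: "nat \<Rightarrow> 'y \<Rightarrow> ereal"
    and p :: "nat \<Rightarrow> (nat \<Rightarrow> real ^ 'y) \<Rightarrow> real ^ 'y \<Rightarrow> real"
  assumes f_measurable: "case_prod f \<in> borel_measurable (borel \<Otimes>\<^sub>M borel)"
    and h_measurable: "h \<in> borel_measurable borel"
    and state_eq: "\<And>k \<omega>. k \<in> {1..n} \<Longrightarrow> \<omega> \<in> space M \<Longrightarrow>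
        x k \<omega> = f (x (k - 1) \<omega>) (u (k - 1) \<omega>) + w (k - 1) \<omega>"
    and output_eq: "\<And>k \<omega>. k \<in> {1..n} \<Longrightarrow> \<omega> \<in> space M \<Longrightarrow> y k \<omega> = h (x k \<omega>) + v k \<omega>"
    and density_w: "\<And>k. k \<le> n \<Longrightarrow>
        (\<forall>s. 0 \<le> pw k s) \<and> distributed M lborel (w k) (\<lambda>s. ennreal (pw k s))"
    and density_v: "\<And>k. k \<in> {1..n} \<Longrightarrow>
        (\<forall>s. 0 \<le> pv k s) \<and> distributed M lborel (v k) (\<lambda>s. ennreal (pv k s))"
    and density_u: "\<And>k. k \<le> n \<Longrightarrow>
        (\<forall>s. 0 \<le> pu k s) \<and> distributed M lborel (u k) (\<lambda>s. ennreal (pu k s))"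
    and density_x0: "(\<forall>s. 0 \<le> px0 s) \<and> distributed M lborel (x 0) (\<lambda>s. ennreal (px0 s))"
    and noise_indep: "indep_sets
        (case_sum (\<lambda>k. rv_events M borel (w k)) (\<lambda>k. rv_events M borel (v k)))
        (Inl ` {..n} \<union> Inr ` {1..n})"
    and uncorrelated_w_u: "\<And>k. k \<le> n \<Longrightarrow> uncorrelated M (w k) (u k)"
    and uncorrelated_v_u: "\<And>k. k \<in> {1..n} \<Longrightarrow> uncorrelated M (v k) (u k)"
    and uncorrelated_w_v: "\<And>k. k \<in> {1..n} \<Longrightarrow> uncorrelated M (w k) (v k)"
    and x0_indep: "indep_set
        (rv_events M borel (x 0))
        (rv_events M
          (Pi\<^sub>M {..n} (\<lambda>_. borel) \<Otimes>\<^sub>M Pi\<^sub>M {1..n} (\<lambda>_. borel) \<Otimes>\<^sub>M Pi\<^sub>M {..n} (\<lambda>_. borel))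
          (\<lambda>\<omega>. (\<lambda>k\<in>{..n}. w k \<omega>, \<lambda>k\<in>{1..n}. v k \<omega>, \<lambda>k\<in>{..n}. u k \<omega>)))"
    and output_support: "\<And>k. k \<in> {1..n} \<Longrightarrow> rv_support M (y k) = ereal_box (lo k) (hi k)"
    and true_cond_density: "\<And>k. k \<in> {1..n} \<Longrightarrow>
        cond_density M (past_space k) (\<lambda>\<omega>. \<lambda>j\<in>{1..<k}. y j \<omega>) (y k) (p k)"


section \<open>Moment information\<close>

definition mi_degree :: "('d::finite \<Rightarrow> nat) \<Rightarrow> nat" where
  "mi_degree \<alpha> = (\<Sum>i\<in>UNIV. \<alpha> i)"

definition mi_power :: "real ^ 'd::finite \<Rightarrow> ('d \<Rightarrow> nat) \<Rightarrow> real" where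
  "mi_power s \<alpha> = (\<Prod>i\<in>UNIV. (s $ i) ^ \<alpha> i)"

text \<open>Finiteness of the moment \<open>\<mu>\<^sub>\<alpha> = \<integral> s\<^sup>\<alpha> q(s) ds\<close> is integrability of the integrand: the
  Bochner integral itself is a real number even when the moment is infinite.\<close>

definition finite_moments :: "nat \<Rightarrow> (real ^ 'd::finite \<Rightarrow> real) \<Rightarrow> bool" where
  "finite_moments m q \<longleftrightarrow>
     (\<forall>\<alpha>. mi_degree \<alpha> \<le> m \<longrightarrow> integrable lborel (\<lambda>s. mi_power s \<alpha> * q s))"

definition moment_info ::
  "nat \<Rightarrow> (nat \<Rightarrow> real ^ 'x::finite \<Rightarrow> real) \<Rightarrow> (nat \<Rightarrow> real ^ 'y::finite \<Rightarrow> real) \<Rightarrow>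
   (nat \<Rightarrow> real ^ 'u::finite \<Rightarrow> real) \<Rightarrow> (real ^ 'x \<Rightarrow> real) \<Rightarrow> nat \<Rightarrow> bool" where
  "moment_info n pw pv pu px0 m \<longleftrightarrow>
     (\<forall>k\<in>{1..n}. finite_moments m (pw k) \<and> finite_moments m (pv k) \<and> finite_moments m (pu k)) \<and>
     finite_moments m px0"


section \<open>Moment robust probabilistic predictors\<close>

definition exp_poly_on ::
  "nat \<Rightarrow> (real ^ 'd::finite) set \<Rightarrow> (('d \<Rightarrow> nat) \<Rightarrow> real) \<Rightarrow> real ^ 'd \<Rightarrow> real" where
  "exp_poly_on m S lam s =
     (if s \<in> S
      then exp (\<Sum>i = 0..m. \<Sum>\<alpha> | mi_degree \<alpha> = i. lam \<alpha> * mi_power s \<alpha>)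
      else 0)"

definition exp_poly_density ::
  "nat \<Rightarrow> (real ^ 'd::finite) set \<Rightarrow> (real ^ 'd \<Rightarrow> real) \<Rightarrow> bool" where
  "exp_poly_density m S q \<longleftrightarrow> prob_density q \<and> (\<exists>lam. q = exp_poly_on m S lam)"

text \<open>A predictor maps a time \<open>k\<close> and past outputs to a density. It has order \<open>m\<close> if, with the
  information that the moments of order up to \<open>m\<close> are finite, its outputs have the stated form.\<close>

definition moment_robust_predictor ::
  "'a measure \<Rightarrow> nat \<Rightarrow> (nat \<Rightarrow> real ^ 'x::finite \<Rightarrow> real) \<Rightarrow> (nat \<Rightarrow> real ^ 'y::finite \<Rightarrow> real) \<Rightarrow>
   (nat \<Rightarrow> real ^ 'u::finite \<Rightarrow> real) \<Rightarrow> (real ^ 'x \<Rightarrow> real) \<Rightarrow> (nat \<Rightarrow> 'a \<Rightarrow> real ^ 'y) \<Rightarrow> nat \<Rightarrow>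
   (nat \<Rightarrow> (nat \<Rightarrow> real ^ 'y) \<Rightarrow> real ^ 'y \<Rightarrow> real) \<Rightarrow> bool" where
  "moment_robust_predictor M n pw pv pu px0 y m F \<longleftrightarrow>
     moment_info n pw pv pu px0 m \<and>
     (\<forall>k\<in>{1..n}. \<forall>past\<in>space (past_space k).
        exp_poly_density m (rv_support M (y k)) (F k past))"

text \<open>The integral of \<open>q log r\<close>, with \<open>log 0 = -\<infinity>\<close> and \<open>0 \<cdot> (-\<infinity>) = 0\<close>. It may be infinite; it is
  \<open>-\<infinity>\<close> whenever the negative part has infinite integral.\<close>

definition elog :: "real \<Rightarrow> ereal" where
  "elog t = (if t = 0 then -\<infinity> else ereal (ln t))"

definition expected_loglik :: "(real ^ 'd::finite \<Rightarrow> real) \<Rightarrow> (real ^ 'd \<Rightarrow> real) \<Rightarrow> ereal" where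
  "expected_loglik q r =
     (let pos = \<integral>\<^sup>+ s. e2ennreal (ereal (q s) * elog (r s)) \<partial>lborel;
          neg = \<integral>\<^sup>+ s. e2ennreal (- (ereal (q s) * elog (r s))) \<partial>lborel
      in if neg = \<infinity> then -\<infinity> else enn2ereal pos - enn2ereal neg)"

definition optimal_moment_robust_predictor ::
  "'a measure \<Rightarrow> nat \<Rightarrow> (nat \<Rightarrow> real ^ 'x::finite \<Rightarrow> real) \<Rightarrow> (nat \<Rightarrow> real ^ 'y::finite \<Rightarrow> real) \<Rightarrow>
   (nat \<Rightarrow> real ^ 'u::finite \<Rightarrow> real) \<Rightarrow> (real ^ 'x \<Rightarrow> real) \<Rightarrow> (nat \<Rightarrow> 'a \<Rightarrow> real ^ 'y) \<Rightarrow>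
   (nat \<Rightarrow> (nat \<Rightarrow> real ^ 'y) \<Rightarrow> real ^ 'y \<Rightarrow> real) \<Rightarrow> nat \<Rightarrow>
   (nat \<Rightarrow> (nat \<Rightarrow> real ^ 'y) \<Rightarrow> real ^ 'y \<Rightarrow> real) \<Rightarrow> bool" where
  "optimal_moment_robust_predictor M n pw pv pu px0 y p m F \<longleftrightarrow>
     moment_robust_predictor M n pw pv pu px0 y m F \<and>
     (\<forall>k\<in>{1..n}. \<forall>past\<in>space (past_space k).
        \<forall>r. exp_poly_density m (rv_support M (y k)) r \<longrightarrow>
          expected_loglik (p k past) r \<le> expected_loglik (p k past) (F k past))"

end

theory Submission
  imports Defs
begin

text \<open>Polynomials of degree zero are constants, so on a set of finite positive volume the
  admissible class contains exactly one density, the uniform one, and optimality is automatic.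
  The point is that the support has positive volume: it carries the full mass of the output,
  whose distribution is absolutely continuous because it is a mixture of conditional densities.\<close>

lemma mi_degree_eq_0_iff: "mi_degree \<alpha> = 0 \<longleftrightarrow> \<alpha> = (\<lambda>_. 0)"
  by (auto simp: mi_degree_def)

lemma mi_power_zero [simp]: "mi_power s (\<lambda>_. 0) = 1"
  by (simp add: mi_power_def)

lemma exp_poly_on_0: "exp_poly_on 0 S lam s = (if s \<in> S then exp (lam (\<lambda>_. 0)) else 0)"
  by (simp add: exp_poly_on_def mi_degree_eq_0_iff)

lemma prob_density_const_on_iff:
  assumes "S \<in> sets borel" "c > 0" "emeasure lborel S = ennreal V" "V > 0"
  shows "prob_density (\<lambda>s. if s \<in> S then c else 0) \<longleftrightarrow> c = inverse V"
proof -
  have "(\<lambda>s. ennreal (if s \<in> S then c else 0)) = (\<lambda>s. ennreal c * indicator S s)"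
    by (auto simp: indicator_def)
  then have "(\<integral>\<^sup>+ s. ennreal (if s \<in> S then c else 0) \<partial>lborel) = ennreal (c * V)"
    using assms by (simp add: nn_integral_cmult_indicator ennreal_mult)
  then show ?thesis
    using assms by (auto simp: prob_density_def field_simps)
qed

text \<open>The only multi-index of degree zero is the zero one, so the exponent is a single
  coefficient. Normalization forces its exponential to be \<open>inverse V\<close>, and every
  positive constant is such an exponential.\<close>

lemma exp_poly_density_0_iff:
  assumes "S \<in> sets borel" "emeasure lborel S = ennreal V" "V > 0"
  shows "exp_poly_density 0 S q \<longleftrightarrow> q = (\<lambda>s. if s \<in> S then inverse V else 0)"
proof
  assume "exp_poly_density 0 S q"
  then obtain lam where q: "q = exp_poly_on 0 S lam" and "prob_density q"
    by (auto simp: exp_poly_density_def)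
  then show "q = (\<lambda>s. if s \<in> S then inverse V else 0)"
    using prob_density_const_on_iff[OF assms(1) exp_gt_zero assms(2,3)]
    by (auto simp: exp_poly_on_0[abs_def])
next
  assume q: "q = (\<lambda>s. if s \<in> S then inverse V else 0)"
  then have "prob_density q"
    using prob_density_const_on_iff[OF assms(1) _ assms(2,3), of "inverse V"] assms(3) by simp
  \<comment> \<open>Only the coefficient at the zero multi-index is read, so a constant family
    serves as witness; \<open>V > 0\<close> makes \<open>exp\<close> undo \<open>ln\<close>.\<close>
  moreover have "q = exp_poly_on 0 S (\<lambda>_. ln (inverse V))"
    using assms(3) by (simp add: q exp_poly_on_0[abs_def] cong: if_cong)
  ultimately show "exp_poly_density 0 S q"
    by (auto simp: exp_poly_density_def)
qed

text \<open>The single moment of order zero is the total mass of the density, finite because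
  constants are integrable on a probability space.\<close>

lemma (in prob_space) finite_moments_0:
  assumes "distributed M lborel X (\<lambda>s. ennreal (q s))" "\<forall>s. 0 \<le> q s"
  shows "finite_moments 0 q"
proof -
  have "integrable lborel (\<lambda>s. q s * 1)"
    using assms by (subst distributed_integrable[OF assms(1)]) auto
  then show ?thesis
    by (auto simp: finite_moments_def mi_degree_eq_0_iff)
qed

text \<open>The complement is the union of all open sets of measure zero. By the Lindelof property
  countably many of them already cover it.\<close>

lemma emeasure_compl_rv_support:
  fixes X :: "'a \<Rightarrow> 'b::second_countable_topology"
  shows "emeasure (distr M borel X) (- rv_support M X) = 0"
proof -
  let ?D = "distr M borel X"
  define \<F> where "\<F> = {U. open U \<and> emeasure ?D U = 0}"
  have eq: "- rv_support M X = \<Union>\<F>"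
    by (auto simp: rv_support_def \<F>_def zero_less_iff_neq_zero)
  obtain \<F>' where "\<F>' \<subseteq> \<F>" "countable \<F>'" "\<Union>\<F>' = \<Union>\<F>"
    using Lindelof[of \<F>] by (auto simp: \<F>_def)
  then have "(\<Union>U\<in>\<F>'. U) \<in> null_sets ?D"
    by (intro null_sets_UN') (auto simp: \<F>_def null_sets_def)
  then show ?thesis
    using \<open>\<Union>\<F>' = \<Union>\<F>\<close> by (simp add: eq null_sets_def)
qed

lemma closed_rv_support: "closed (rv_support M X)"
proof -
  have "- rv_support M X = \<Union>{U. open U \<and> emeasure (distr M borel X) U = 0}"
    by (auto simp: rv_support_def zero_less_iff_neq_zero)
  then show ?thesis
    by (simp add: closed_def open_Union)
qed

text \<open>This is absolute continuity of the law of \<open>Y\<close>: taking all of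
  \<open>N\<close> as the conditioning event writes the probability of \<open>B\<close> as a mixture
  of integrals over \<open>B\<close>, each of which vanishes.\<close>

lemma cond_density_null_sets:
  assumes "cond_density M N Z Y p" "\<And>\<omega>. \<omega> \<in> space M \<Longrightarrow> Z \<omega> \<in> space N" "B \<in> null_sets lborel"
  shows "emeasure M (Y -` B \<inter> space M) = 0"
proof -
  have null: "(\<integral>\<^sup>+ s\<in>B. ennreal (p z s) \<partial>lborel) = 0" for z
    by (rule nn_integral_null_set[OF assms(3)])
  have "{\<omega>\<in>space M. Z \<omega> \<in> space N \<and> Y \<omega> \<in> B} = Y -` B \<inter> space M"
    using assms(2) by auto
  moreover have "emeasure M {\<omega>\<in>space M. Z \<omega> \<in> space N \<and> Y \<omega> \<in> B} =
      (\<integral>\<^sup>+ z\<in>space N. (\<integral>\<^sup>+ s\<in>B. ennreal (p z s) \<partial>lborel) \<partial>distr M N Z)"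
    using assms(1,3) by (auto simp: cond_density_def null_sets_def)
  ultimately show ?thesis
    by (simp add: null)
qed

text \<open>A point of the box excludes the values \<open>lo i = \<infinity>\<close> and
  \<open>hi i = -\<infinity>\<close>, for which \<open>real_of_ereal\<close> would return the
  default 0 and the two boxes could differ.\<close>

lemma ereal_box_eq_cbox:
  assumes "\<And>i. lo i > -\<infinity>" "\<And>i. hi i < \<infinity>" "ereal_box lo hi \<noteq> {}"
  shows "ereal_box lo hi =
    cbox (\<chi> i. real_of_ereal (lo i)) (\<chi> i. real_of_ereal (hi i))"
proof -
  obtain t where t: "\<And>i. lo i \<le> ereal (t $ i)" "\<And>i. ereal (t $ i) \<le> hi i"
    using assms(3) by (auto simp: ereal_box_def)
  have "lo i \<le> ereal a \<longleftrightarrow> real_of_ereal (lo i) \<le> a"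
    "ereal a \<le> hi i \<longleftrightarrow> a \<le> real_of_ereal (hi i)" for i a
    using assms(1,2)[of i] t[of i] by (cases "lo i"; cases "hi i"; simp)+
  then show ?thesis
    by (auto simp: ereal_box_def mem_box_cart)
qed

context stochastic_system
begin

text \<open>Measurability passes along the recursion from the initial state, the inputs and the
  noises, whose densities supply it.\<close>

lemma state_measurable: "k \<le> n \<Longrightarrow> x k \<in> borel_measurable M"
proof (induction k)
  case 0
  then show ?case
    using density_x0 by (auto simp: distributed_def)
next
  case (Suc k)
  have [measurable]: "x k \<in> borel_measurable M" "u k \<in> borel_measurable M"
      "w k \<in> borel_measurable M"
    using Suc density_u[of k] density_w[of k] by (auto simp: distributed_def)
  note [measurable] = f_measurable
  have "(\<lambda>\<omega>. case_prod f (x k \<omega>, u k \<omega>) + w k \<omega>) \<in> borel_measurable M"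
    by measurable
  then show ?case
    using state_eq[of "Suc k"] Suc.prems by (subst measurable_cong) auto
qed

lemma output_measurable:
  assumes "k \<in> {1..n}"
  shows "y k \<in> borel_measurable M"
proof -
  note [measurable] = h_measurable
  have [measurable]: "x k \<in> borel_measurable M" "v k \<in> borel_measurable M"
    using assms state_measurable density_v[of k] by (auto simp: distributed_def)
  have "(\<lambda>\<omega>. h (x k \<omega>) + v k \<omega>) \<in> borel_measurable M"
    by measurable
  then show ?thesis
    using output_eq[OF assms] by (subst measurable_cong) auto
qed

text \<open>If the support were Lebesgue-null, the output would lie in it with probability zero. It
  also avoids it with probability zero, which contradicts total mass one.\<close>

lemma emeasure_output_support_pos:
  assumes "k \<in> {1..n}"
  shows "emeasure lborel (rv_support M (y k)) > 0"
proof (rule ccontr)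
  let ?S = "rv_support M (y k)"
  note [measurable] = output_measurable[OF assms] borel_closed[OF closed_rv_support[of M "y k"]]
  assume "\<not> emeasure lborel ?S > 0"
  then have "?S \<in> null_sets lborel"
    by (auto simp: null_sets_def zero_less_iff_neq_zero)
  then have "emeasure M (y k -` ?S \<inter> space M) = 0"
    by (intro cond_density_null_sets[OF true_cond_density[OF assms]]) (auto simp: space_PiM)
  moreover have "emeasure M (y k -` (- ?S) \<inter> space M) = 0"
    using emeasure_compl_rv_support[of M "y k"] by (simp add: emeasure_distr)
  ultimately have "emeasure M ((y k -` ?S \<inter> space M) \<union> (y k -` (- ?S) \<inter> space M)) = 0"
    by (intro emeasure_Un_null_set[THEN trans]) (auto simp: null_sets_def)
  moreover have "(y k -` ?S \<inter> space M) \<union> (y k -` (- ?S) \<inter> space M) = space M"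
    by auto
  ultimately show False
    using emeasure_space_1 by simp
qed

lemma output_support_volume:
  assumes "k \<in> {1..n}" "\<And>i. lo k i > -\<infinity>" "\<And>i. hi k i < \<infinity>"
  defines "V \<equiv> \<Prod>i\<in>UNIV. real_of_ereal (hi k i) - real_of_ereal (lo k i)"
  shows "emeasure lborel (rv_support M (y k)) = ennreal V" "V > 0"
proof -
  let ?S = "rv_support M (y k)"
  let ?a = "\<chi> i. real_of_ereal (lo k i)" and ?b = "\<chi> i. real_of_ereal (hi k i)"
  have pos: "emeasure lborel ?S > 0"
    by (rule emeasure_output_support_pos[OF assms(1)])
  then have ne: "?S \<noteq> {}"
    by auto
  have S: "?S = cbox ?a ?b"
    using ereal_box_eq_cbox[of "lo k" "hi k"] assms(2,3) ne output_support[OF assms(1)] by simp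
  \<comment> \<open>Nonemptiness matters here: an empty box has content 0, while a product of
    differences with two negative factors can be positive.\<close>
  have "measure lborel (cbox ?a ?b) = V"
    using ne content_cbox_cart[of ?a ?b] by (simp add: S V_def)
  then show "emeasure lborel ?S = ennreal V"
    using emeasure_eq_ennreal_measure[of lborel "cbox ?a ?b"] emeasure_lborel_cbox_finite[of ?a ?b]
    by (simp add: S less_top[symmetric])
  \<comment> \<open>Positive volume, rather than an assumed strict order of the bounds, excludes
    degenerate sides.\<close>
  with pos show "V > 0"
    by simp
qed

lemma moment_info_0: "moment_info n pw pv pu px0 0"
  unfolding moment_info_def
proof (intro conjI ballI)
  fix k assume "k \<in> {1..n}"
  then show "finite_moments 0 (pw k)" "finite_moments 0 (pv k)" "finite_moments 0 (pu k)"
    using density_w[of k] density_v[of k] density_u[of k] finite_moments_0 by auto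
qed (use density_x0 finite_moments_0 in auto)

end

theorem theorem3:
  fixes M :: "'a measure"
    and n :: nat
    and f :: "real ^ 'x::finite \<Rightarrow> real ^ 'u::finite \<Rightarrow> real ^ 'x"
    and h :: "real ^ 'x \<Rightarrow> real ^ 'y::finite"
    and x w :: "nat \<Rightarrow> 'a \<Rightarrow> real ^ 'x"
    and u :: "nat \<Rightarrow> 'a \<Rightarrow> real ^ 'u"
    and v y :: "nat \<Rightarrow> 'a \<Rightarrow> real ^ 'y"
    and pw :: "nat \<Rightarrow> real ^ 'x \<Rightarrow> real"
    and pv :: "nat \<Rightarrow> real ^ 'y \<Rightarrow> real"
    and pu :: "nat \<Rightarrow> real ^ 'u \<Rightarrow> real"
    and px0 :: "real ^ 'x \<Rightarrow> real"
    and lo hi :: "nat \<Rightarrow> 'y \<Rightarrow> ereal"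
    and p :: "nat \<Rightarrow> (nat \<Rightarrow> real ^ 'y) \<Rightarrow> real ^ 'y \<Rightarrow> real"
  assumes system: "stochastic_system M n f h x w u v y pw pv pu px0 lo hi p"
    and lo_finite: "\<And>k i. k \<in> {1..n} \<Longrightarrow> lo k i > -\<infinity>"
    and hi_finite: "\<And>k i. k \<in> {1..n} \<Longrightarrow> hi k i < \<infinity>"
  shows "(\<exists>F. optimal_moment_robust_predictor M n pw pv pu px0 y p 0 F) \<and>
    (\<forall>F. optimal_moment_robust_predictor M n pw pv pu px0 y p 0 F \<longrightarrow>
      (\<forall>k\<in>{1..n}. \<forall>past\<in>space (past_space k). \<forall>s.
        F k past s =
          (if s \<in> rv_support M (y k)
           then \<Prod>i\<in>UNIV. inverse (real_of_ereal (hi k i) - real_of_ereal (lo k i))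
           else 0)))"
proof -
  interpret stochastic_system M n f h x w u v y pw pv pu px0 lo hi p
    by (rule system)
  define G where "G k s =
    (if s \<in> rv_support M (y k)
     then \<Prod>i\<in>UNIV. inverse (real_of_ereal (hi k i) - real_of_ereal (lo k i)) else 0)" for k s
  \<comment> \<open>The product of inverses becomes the inverse of the volume, the form in which
    uniqueness is available.\<close>
  have G_eq: "G k s =
    (if s \<in> rv_support M (y k)
     then inverse (\<Prod>i\<in>UNIV. real_of_ereal (hi k i) - real_of_ereal (lo k i)) else 0)" for k s
    by (simp add: G_def comp_def flip: prod_inversef)
  have unique: "exp_poly_density 0 (rv_support M (y k)) q \<longleftrightarrow> q = G k" if "k \<in> {1..n}" for k q
    using exp_poly_density_0_iff[OF borel_closed[OF closed_rv_support]
        output_support_volume[OF that lo_finite[OF that] hi_finite[OF that]]]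
    by (simp add: G_eq[abs_def])
  \<comment> \<open>With a single admissible density at each time, every competitor equals the
    prediction itself. The likelihood inequality is then reflexive, whatever value the expected
    log-likelihood takes.\<close>
  have "optimal_moment_robust_predictor M n pw pv pu px0 y p 0 F \<longleftrightarrow>
      (\<forall>k\<in>{1..n}. \<forall>past\<in>space (past_space k). F k past = G k)" for F
    using moment_info_0 unique
    by (auto simp: optimal_moment_robust_predictor_def moment_robust_predictor_def)
  then show ?thesis
    \<comment> \<open>Existence is witnessed by the predictor that ignores the past and returns
      \<open>G k\<close>.\<close>
    by (auto simp: G_def intro!: exI[of _ "\<lambda>k _. G k"])
qed

end
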